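(* Let $G$ be a triangle-free finite simple graph with maximum degree at most $3$. If $G$ is $2$-connected and $\mathrm{girth}(G)\le 6$, then $V(G)$ can be partitioned into at most $42$ admissible sets.
   Context: For a vertex $u$ and positive integer $i$, $N_G^i(u)=\{v\in V(G): v\ne u \text{ and there is a path of length } i \text{ in } G \text{ connecting } u \text{ and } v\}$. A set $X\subseteq V(G)$ is admissible if it can be partitioned into three sets $X_1,X_2,X_3$ such that: (1) if $\{u,v\}\subseteq X_i$ for some $i$, then $v\notin N_G^1(u)\cup N_G^3(u)\cup N_G^5(u)$; (2) if $u\in X_i$ and $v\in X_j$ with $i\ne j$, then $v\notin N_G^1(u)\cup N_G^2(u)\cup N_G^4(u)$. *)

theory Defs
  imports "Graph_Theory.Graph_Theory" "HOL-Library.Extended_Nat" "HOL-Library.Disjoint_Sets"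
begin

text \<open>
  A finite simple graph is a \<open>pair_graph\<close>: finite, loop-free, without parallel arcs, and
  symmetric, so that an undirected edge is represented by two opposite arcs. The degree of a vertex
  is therefore its out-degree.
\<close>

definition max_degree :: "('a, 'b) pre_digraph \<Rightarrow> nat" where
  "max_degree G = (SUP v\<in>verts G. out_degree G v)"

definition triangle_free :: "('a, 'b) pre_digraph \<Rightarrow> bool" where
  "triangle_free G \<longleftrightarrow> \<not> (\<exists>u v w. u \<rightarrow>\<^bsub>G\<^esub> v \<and> v \<rightarrow>\<^bsub>G\<^esub> w \<and> w \<rightarrow>\<^bsub>G\<^esub> u)"

definition k_connected :: "nat \<Rightarrow> ('a, 'b) pre_digraph \<Rightarrow> bool" where
  "k_connected k G \<longleftrightarrow>
     card (verts G) > k \<and>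
     (\<forall>S\<subseteq>verts G. finite S \<and> card S < k \<longrightarrow> connected (G \<restriction> (verts G - S)))"

text \<open>
  An edge traversed back and forth is a \<open>pre_digraph.cycle\<close> of length 2, but not a cycle of the
  undirected graph; hence the lower bound 3. The infimum of the empty set is \<open>\<infinity>\<close>.
\<close>

definition girth :: "('a, 'b) pre_digraph \<Rightarrow> enat" where
  "girth G = (INF p\<in>{p. pre_digraph.cycle G p \<and> 3 \<le> length p}. enat (length p))"

definition path_nbhd :: "('a, 'b) pre_digraph \<Rightarrow> nat \<Rightarrow> 'a \<Rightarrow> 'a set" where
  "path_nbhd G i u =
     {v \<in> verts G. v \<noteq> u \<and> (\<exists>p. pre_digraph.apath G u p v \<and> length p = i)}"

text \<open>The parts \<open>Y 1\<close>, \<open>Y 2\<close>, \<open>Y 3\<close> may be empty.\<close>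

definition admissible :: "('a, 'b) pre_digraph \<Rightarrow> 'a set \<Rightarrow> bool" where
  "admissible G X \<longleftrightarrow> X \<subseteq> verts G \<and>
     (\<exists>Y :: nat \<Rightarrow> 'a set.
        X = (\<Union>i\<in>{1..3}. Y i) \<and> disjoint_family_on Y {1..3} \<and>
        (\<forall>i\<in>{1..3}. \<forall>u\<in>Y i. \<forall>v\<in>Y i.
           v \<notin> path_nbhd G 1 u \<union> path_nbhd G 3 u \<union> path_nbhd G 5 u) \<and>
        (\<forall>i\<in>{1..3}. \<forall>j\<in>{1..3}. i \<noteq> j \<longrightarrow> (\<forall>u\<in>Y i. \<forall>v\<in>Y j.
           v \<notin> path_nbhd G 1 u \<union> path_nbhd G 2 u \<union> path_nbhd G 4 u)))"

end

theory Submission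
  imports Defs
begin

text \<open>
  Give every vertex one of the \<open>42 * 3 = 126\<close> pairs (class, part), greedily, in order of decreasing
  distance to a fixed cycle \<open>C\<close> of length at most 6. A coloured vertex \<open>v\<close> forbids at \<open>u\<close> three
  pairs if it is adjacent to \<open>u\<close>, two if it is only at the end of a path of length 2 or 4, and
  one if it is only at the end of a path of length 3 or 5. There are at most 3, 6, 12, 24, 48 end
  points of paths of length 1 to 5, so at most 9 + 12 + 12 + 48 + 48 = 129 pairs are forbidden, and
  it suffices to save four. A vertex outside \<open>C\<close> has an uncoloured neighbour closer to \<open>C\<close>, which in
  turn has another uncoloured neighbour: this saves 3 + 2. On \<open>C\<close>, the two ways round the cycle
  reach the same vertex, so that it is counted twice.
\<close>

lemma card_Un_le_diff:
  assumes "finite A" "finite B" "C \<subseteq> A \<inter> B"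
  shows "card (A \<union> B) \<le> card A + card B - card C"
proof -
  have "card (A \<union> B) + card (A \<inter> B) = card A + card B"
    using assms(1,2) card_Un_Int by metis
  moreover have "card C \<le> card (A \<inter> B)"
    using assms by (intro card_mono) auto
  ultimately show ?thesis by linarith
qed

context pair_graph
begin

section \<open>End points of paths and their last arcs\<close>

abbreviation nbhd :: "nat \<Rightarrow> 'a \<Rightarrow> 'a set" where
  "nbhd \<equiv> path_nbhd (with_proj G)"

text \<open>
  Paths are counted by their last arcs: from an arc \<open>(x, y)\<close>, a path continues in at most two ways,
  as it does not go back along \<open>(y, x)\<close>.
\<close>

definition last_arcs :: "nat \<Rightarrow> 'a \<Rightarrow> ('a \<times> 'a) set" where
  "last_arcs i u = {last p | p v. apath u p v \<and> length p = i}"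

lemma nbhd_sym: "u \<in> pverts G \<Longrightarrow> v \<in> nbhd i u \<Longrightarrow> u \<in> nbhd i v"
proof -
  have length: "length (rev_path p) = length p" for p :: "('a \<times> 'a) list"
    by (induction p) auto
  assume "u \<in> pverts G" "v \<in> nbhd i u"
  then show ?thesis
    unfolding path_nbhd_def by auto (metis length apath_rev_path)
qed

lemma finite_nbhd [simp]: "finite (nbhd i u)"
  by (rule finite_subset[OF _ finite_verts]) (auto simp: path_nbhd_def)

lemma nbhd_subset_last_arcs: "nbhd i u \<subseteq> snd ` last_arcs i u"
proof
  fix v assume "v \<in> nbhd i u"
  then obtain p where p: "apath u p v" "length p = i" "v \<noteq> u"
    by (auto simp: path_nbhd_def)
  then have "p \<noteq> []" by (auto simp: apath_Nil_iff)
  then have "snd (last p) = v"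
    using p(1) by (cases p rule: rev_cases) (auto simp: apath_def awalk_simps)
  then show "v \<in> snd ` last_arcs i u"
    using p by (force simp: last_arcs_def)
qed

lemma last_arcs_subset: "0 < i \<Longrightarrow> last_arcs i u \<subseteq> parcs G"
  by (force simp: last_arcs_def apath_def awalk_def)

text \<open>Removing the final arc of a path leaves a path, whose last arc \<open>(x, y)\<close>
  exists because \<open>0 < i\<close>. The removed arc starts at \<open>y\<close> and cannot be
  \<open>(y, x)\<close>, since that would visit \<open>x\<close> twice.\<close>

lemma last_arcs_Suc:
  assumes "0 < i"
  shows "last_arcs (Suc i) u \<subseteq> (\<Union>(x, y) \<in> last_arcs i u. out_arcs G y - {(y, x)})"
proof
  fix e assume "e \<in> last_arcs (Suc i) u"
  then obtain p v where p: "apath u p v" "length p = Suc i" "last p = e"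
    by (auto simp: last_arcs_def)
  then obtain q where q: "p = q @ [e]" "length q = i"
    by (cases p rule: rev_cases) auto
  then obtain r x y where r: "q = r @ [(x, y)]"
    using assms by (cases q rule: rev_cases) auto
  have "apath u q (last (pawalk_verts u q))"
    using p(1) unfolding q(1) apath_append_iff by (rule conjunct1)
  then have "apath u q y"
    unfolding r by (auto simp: apath_def awalk_simps)
  then have "(x, y) \<in> last_arcs i u"
    using q r by (force simp: last_arcs_def)
  moreover have "e \<in> out_arcs G y - {(y, x)}"
    using p(1) q r by (cases e) (auto simp: apath_append_iff apath_simps awalk_simps out_arcs_def)
  ultimately show "e \<in> (\<Union>(x, y) \<in> last_arcs i u. out_arcs G y - {(y, x)})"
    by blast
qed

section \<open>A cycle seen from each of its vertices, and the distance to it\<close>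

text \<open>A closed walk can be rotated to start at any of its vertices. Distinctness of the heads
  \<open>map snd q\<close> survives rotation. The last clause keeps the walk inside
  \<open>C\<close>, so that a vertex of \<open>C\<close> has a successor in
  \<open>C\<close>.\<close>

lemma cycle_at_vertex:
  assumes "cycle p"
  obtains C where "C \<subseteq> pverts G" "C \<noteq> {}"
    and "\<And>u. u \<in> C \<Longrightarrow> \<exists>q. awalk u q u \<and> distinct (map snd q) \<and> length q = length p \<and> snd ` set q \<subseteq> C"
proof -
  have tl_verts: "tl (pawalk_verts u q) = map snd q" if "pcas u q v" for u v and q :: "('a \<times> 'a) list"
    using that
  proof (induction q arbitrary: u)
    case (Cons e q)
    then show ?case by (cases q) auto
  qed auto
  obtain u0 where u0: "awalk u0 p u0" "distinct (tl (pawalk_verts u0 p))" "p \<noteq> []"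
    using assms by (auto simp: cycle_def)
  then have dist: "distinct (map snd p)"
    using tl_verts by (metis awalk_def)
  show thesis
  proof (rule that[of "snd ` set p"])
    show "snd ` set p \<subseteq> pverts G" "snd ` set p \<noteq> {}"
      using u0 by (auto simp: awalk_def in_arcsD2)
    fix u assume "u \<in> snd ` set p"
    then obtain w where "(w, u) \<in> set p" by auto
    then obtain q r where p: "p = (q @ [(w, u)]) @ r"
      by (metis append.assoc append_Cons append_Nil in_set_conv_decomp)
    then have "awalk u0 (q @ [(w, u)]) u \<and> awalk u r u0"
      using u0(1) by (auto simp: awalk_simps)
    then have "awalk u (r @ (q @ [(w, u)])) u" 
      by (meson awalk_appendI)
    with p dist show "\<exists>q. awalk u q u \<and> distinct (map snd q) \<and> length q = length p \<and> snd ` set q \<subseteq> snd ` set p"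
      by (intro exI[of _ "r @ (q @ [(w, u)])"]) auto
  qed
qed

text \<open>Take for \<open>d\<close> the length of a shortest walk into \<open>C\<close>. Outside
  \<open>C\<close> such a walk has a first arc, and the rest of it shows that the next vertex is
  closer.\<close>

lemma ex_decreasing_rank:
  assumes "connected G" "C \<subseteq> pverts G" "C \<noteq> {}"
  obtains d :: "'a \<Rightarrow> nat" where "\<And>v. v \<in> C \<Longrightarrow> d v = 0"
    and "\<And>v. v \<in> pverts G \<Longrightarrow> v \<notin> C \<Longrightarrow> \<exists>w. (v, w) \<in> parcs G \<and> d w < d v"
proof -
  define P where "P v n \<longleftrightarrow> (\<exists>p c. c \<in> C \<and> awalk v p c \<and> length p = n)" for v n
  have ex: "\<exists>n. P v n" if "v \<in> pverts G" for v
  proof -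
    have "strongly_connected G"
      using assms(1) sym_arcs symmetric_connected_imp_strongly_connected by blast
    with assms that obtain c where "c \<in> C" "v \<rightarrow>\<^sup>*\<^bsub>G\<^esub> c"
      by (auto simp: strongly_connected_def)
    then show ?thesis by (auto simp: P_def reachable_awalk)
  qed
  show thesis
  proof (rule that[of "\<lambda>v. LEAST n. P v n"])
    fix v assume "v \<in> C"
    then have "P v 0" using assms(2) by (auto simp: P_def awalk_Nil_iff)
    then show "(LEAST n. P v n) = 0" by (simp add: Least_eq_0)
  next
    fix v assume v: "v \<in> pverts G" "v \<notin> C"
    then have "P v (LEAST n. P v n)" using ex LeastI_ex by metis
    then obtain p c where p: "c \<in> C" "awalk v p c" "length p = (LEAST n. P v n)"
      by (auto simp: P_def)
    then obtain w q where q: "p = (v, w) # q"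
      using v by (cases p) (auto simp: awalk_simps)
    then have "P w (length q)" "(v, w) \<in> parcs G"
      using p by (auto simp: P_def awalk_simps)
    then have "(LEAST n. P w n) < (LEAST n. P v n)"
      using p(3) q Least_le[of "P w" "length q"] by simp
    then show "\<exists>w. (v, w) \<in> parcs G \<and> (LEAST n. P w n) < (LEAST n. P v n)"
      using \<open>(v, w) \<in> parcs G\<close> by blast
  qed
qed

end

section \<open>Counting in graphs of maximum degree at most 3\<close>

locale subcubic_graph = pair_graph +
  assumes out_degree_le: "\<And>v. v \<in> pverts G \<Longrightarrow> out_degree G v \<le> 3"
begin

text \<open>There are at most 3 first arcs. Each further step at most doubles the number: one of the
  at most 3 arcs leaving \<open>y\<close> is the reverse of the arc just used.\<close>

lemma card_last_arcs: "0 < i \<Longrightarrow> card (last_arcs i u) \<le> 3 * 2 ^ (i - 1)"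
proof (induction i)
  case (Suc i)
  show ?case
  proof (cases "i = 0")
    case True
    have "last_arcs 1 u \<subseteq> out_arcs G u"
      by (auto simp: last_arcs_def length_Suc_conv apath_simps)
    moreover have "card (out_arcs G u) \<le> 3"
    proof (cases "u \<in> pverts G")
      case False
      then have "out_arcs G u = {}" by (auto simp: out_arcs_def in_arcsD1)
      then show ?thesis by simp
    qed (use out_degree_le in \<open>auto simp: out_degree_def\<close>)
    ultimately show ?thesis
      using True card_mono[OF finite_out_arcs] by (metis One_nat_def diff_self_eq_0 le_trans mult.right_neutral power_0)
  next
    case False
    then have sub: "last_arcs i u \<subseteq> parcs G" by (simp add: last_arcs_subset)
    then have fin: "finite (last_arcs i u)" using finite_arcs finite_subset by blast
    have le: "card (out_arcs G y - {(y, x)}) \<le> 2" if "(x, y) \<in> last_arcs i u" for x y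
    proof -
      from that sub have "(x, y) \<in> parcs G" by auto
      then have "(y, x) \<in> out_arcs G y" "y \<in> pverts G"
        using arcs_symmetric by (auto simp: in_arcsD2)
      then show ?thesis
        using out_degree_le[of y] by (auto simp: out_degree_def card_Diff_singleton finite_out_arcs)
    qed
    have "card (last_arcs (Suc i) u) \<le> card (\<Union>(x, y) \<in> last_arcs i u. out_arcs G y - {(y, x)})"
      using False fin by (intro card_mono last_arcs_Suc) (auto intro: finite_out_arcs)
    also have "\<dots> \<le> (\<Sum>(x, y) \<in> last_arcs i u. card (out_arcs G y - {(y, x)}))"
      using card_UN_le[OF fin, of "\<lambda>(x, y). out_arcs G y - {(y, x)}"]
      by (simp add: case_prod_unfold)
    also have "\<dots> \<le> (\<Sum>_ \<in> last_arcs i u. 2)"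
      using le by (intro sum_mono) auto
    also have "\<dots> \<le> 3 * 2 ^ (Suc i - 1)"
      using Suc.IH False by (cases i) auto
    finally show ?thesis .
  qed
qed auto

lemma finite_last_arcs: "0 < i \<Longrightarrow> finite (last_arcs i u)"
  using last_arcs_subset finite_arcs finite_subset by metis

lemma card_nbhd:
  assumes "0 < i"
  shows "card (nbhd i u) \<le> 3 * 2 ^ (i - 1)"
proof -
  have "card (nbhd i u) \<le> card (last_arcs i u)"
    using nbhd_subset_last_arcs finite_last_arcs[OF assms] by (rule surj_card_le[rotated])
  with card_last_arcs[OF assms] show ?thesis by (rule order_trans[rotated])
qed

lemma card_nbhds:
  shows card_nbhd_1: "card (nbhd 1 u) \<le> 3" and card_nbhd_2: "card (nbhd 2 u) \<le> 6"
    and card_nbhd_3: "card (nbhd 3 u) \<le> 12" and card_nbhd_4: "card (nbhd 4 u) \<le> 24"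
    and card_nbhd_5: "card (nbhd 5 u) \<le> 48"
  by (rule order_trans[OF card_nbhd]; simp)+

section \<open>Bounds on the number of forbidden colours\<close>

text \<open>An upper bound for the number of pairs forbidden at \<open>u\<close> when \<open>S\<close> is the set of coloured vertices.\<close>

definition weight :: "'a set \<Rightarrow> 'a \<Rightarrow> nat" where
  "weight S u = 3 * card (nbhd 1 u \<inter> S) + 2 * card ((nbhd 2 u \<union> nbhd 4 u - nbhd 1 u) \<inter> S)
     + card ((nbhd 3 u \<union> nbhd 5 u - nbhd 1 u) \<inter> S)"

lemma weight_closed_walk:
  assumes "awalk u p u" "distinct (map snd p)" "3 \<le> length p" "length p \<le> 6"
  shows "weight S u \<le> 125"
proof -
  note fin = finite_nbhd[of _ u]
  define A where "A = nbhd 2 u \<union> nbhd 4 u"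
  define B where "B = nbhd 3 u \<union> nbhd 5 u"
  \<comment> \<open>Here \<open>S\<close> drops out: every vertex is counted as if coloured. With at
    most 30 points in \<open>A\<close> and 60 in \<open>B\<close> this gives 129, so each cycle
    length has to save 4.\<close>
  have w: "weight S u \<le> 3 * 3 + 2 * card (A - nbhd 1 u) + card (B - nbhd 1 u)"
    unfolding weight_def A_def B_def
    by (intro add_mono mult_left_mono order_trans[OF card_mono card_nbhds(1)] card_mono) auto
  have A: "card A \<le> 30" "card (A - nbhd 1 u) \<le> card A" 
    and B: "card B \<le> 60" "card (B - nbhd 1 u) \<le> card B"
    unfolding A_def B_def
    using card_Un_le[of "nbhd 2 u" "nbhd 4 u"] card_Un_le[of "nbhd 3 u" "nbhd 5 u"] card_nbhds[of u]
    by (auto intro!: card_mono)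
  \<comment> \<open>Neighbours of \<open>u\<close> are already charged 3 each, so each one found in
    \<open>A\<close> saves 2 and each one found in \<open>B\<close> saves 1.\<close>
  have D: "card (X - nbhd 1 u) \<le> card X - card {x, y}"
    if "{x, y} \<subseteq> X \<inter> nbhd 1 u" "finite X" for X x y
  proof -
    have "card (X - nbhd 1 u) \<le> card (X - {x, y})"
      using that by (intro card_mono) auto
    also have "\<dots> = card X - card {x, y}"
      using that by (intro card_Diff_subset) auto
    finally show ?thesis .
  qed
  have nb: "v \<in> nbhd i u" if "apath u q v" "length q = i" "0 < i" for q v i
    using that apath_nonempty_ends[of u q v] by (auto simp: path_nbhd_def apath_def)
  have "(snd e, fst e) \<in> parcs G" if "e \<in> set p" for e
    using assms(1) that arcs_symmetric[of "fst e" "snd e"] by (auto simp: awalk_def)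
  then have rev: "\<forall>(x, y)\<in>set p. (y, x) \<in> parcs G" by auto
  from assms(3,4) consider "length p = 3" | "length p = 4" | "length p = 5" | "length p = 6"
    by linarith
  then show ?thesis
  proof cases
    \<comment> \<open>Both neighbours on the triangle also end paths of length 2, which saves 2 +
      2.\<close>
    case 1
    then obtain a b where p: "p = [(u, a), (a, b), (b, u)]"
      using assms(1) by (auto simp: eval_nat_numeral length_Suc_conv awalk_simps)
    then have "{a, b} \<subseteq> A \<inter> nbhd 1 u"
      using assms p rev nb[of "[(u, a)]" a 1] nb[of "[(u, b)]" b 1] nb[of "[(u, b), (b, a)]" a 2]
        nb[of "[(u, a), (a, b)]" b 2] unfolding A_def
      by (auto simp: apath_simps awalk_simps in_arcsD2)
    moreover have "a \<noteq> b" using p assms by auto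
    ultimately show ?thesis using D[of a b A] w A B fin by (simp add: A_def)
  next
    \<comment> \<open>The neighbours \<open>a\<close> and \<open>c\<close> end paths of length 3,
      which saves 1 + 1. The opposite vertex \<open>b\<close> is the head of two different last
      arcs, so \<open>nbhd 2 u\<close> has at most 5 elements, which saves another 2.\<close>
    case 2
    then obtain a b c where p: "p = [(u, a), (a, b), (b, c), (c, u)]"
      using assms(1) by (auto simp: eval_nat_numeral length_Suc_conv awalk_simps)
    then have "{a, c} \<subseteq> B \<inter> nbhd 1 u"
      using assms p rev nb[of "[(u, a)]" a 1] nb[of "[(u, c)]" c 1] nb[of "[(u, c), (c, b), (b, a)]" a 3]
        nb[of "[(u, a), (a, b), (b, c)]" c 3] unfolding B_def
      by (auto simp: apath_simps awalk_simps in_arcsD2)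
    moreover have ac: "a \<noteq> c" using p assms by auto
    moreover have "card (nbhd 2 u) \<le> 5"
    proof -
      have "apath u [(u, a), (a, b)] b" "apath u [(u, c), (c, b)] b"
        using p assms rev by (auto simp: apath_simps awalk_simps in_arcsD2)
      then have L: "(a, b) \<in> last_arcs 2 u" "(c, b) \<in> last_arcs 2 u"
        unfolding last_arcs_def by force+
      then have "snd ` last_arcs 2 u = snd ` (last_arcs 2 u - {(c, b)})"
      proof -
        have "b \<in> snd ` (last_arcs 2 u - {(c, b)})"
          using L(1) ac by (intro image_eqI[of _ _ "(a, b)"]) auto
        then show ?thesis
          by (metis L(2) image_insert insert_Diff insert_absorb snd_conv)
      qed
      then have "card (nbhd 2 u) \<le> card (last_arcs 2 u - {(c, b)})"
        using nbhd_subset_last_arcs[of 2 u] finite_last_arcs[of 2 u] by (intro surj_card_le) auto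
      then show ?thesis
        using L card_last_arcs[of 2 u] finite_last_arcs[of 2 u] by (simp add: card_Diff_singleton)
    qed
    then have "card A \<le> 29"
      unfolding A_def using card_Un_le[of "nbhd 2 u" "nbhd 4 u"] card_nbhd_4[of u] by linarith
    ultimately show ?thesis using D[of a c B] w A B fin by (simp add: B_def)
  next
    \<comment> \<open>The neighbours \<open>a\<close> and \<open>d\<close> end the paths of length 4
      around the cycle, which saves 2 + 2.\<close>
    case 3
    then obtain a b c d where p: "p = [(u, a), (a, b), (b, c), (c, d), (d, u)]"
      using assms(1) by (auto simp: eval_nat_numeral length_Suc_conv awalk_simps)
    then have "{a, d} \<subseteq> A \<inter> nbhd 1 u"
      using assms p rev nb[of "[(u, a)]" a 1] nb[of "[(u, d)]" d 1]
        nb[of "[(u, d), (d, c), (c, b), (b, a)]" a 4] nb[of "[(u, a), (a, b), (b, c), (c, d)]" d 4]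
      unfolding A_def by (auto simp: apath_simps awalk_simps in_arcsD2)
    moreover have "a \<noteq> d" using p assms by auto
    ultimately show ?thesis using D[of a d A] w A B fin by (simp add: A_def)
  next
    \<comment> \<open>The vertices \<open>b\<close> and \<open>d\<close> end paths of length 2 one
      way round and 4 the other way, which saves 2 + 2. The neighbours \<open>a\<close> and
      \<open>e\<close> end paths of length 5, which saves 1 + 1 more.\<close>
    case 4
    then obtain a b c d e where p: "p = [(u, a), (a, b), (b, c), (c, d), (d, e), (e, u)]"
      using assms(1) by (auto simp: eval_nat_numeral length_Suc_conv awalk_simps)
    then have "{b, d} \<subseteq> nbhd 2 u \<inter> nbhd 4 u"
      using assms p rev nb[of "[(u, a), (a, b)]" b 2] nb[of "[(u, e), (e, d)]" d 2]
        nb[of "[(u, e), (e, d), (d, c), (c, b)]" b 4] nb[of "[(u, a), (a, b), (b, c), (c, d)]" d 4]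
      by (auto simp: apath_simps awalk_simps in_arcsD2)
    then have "card A \<le> card (nbhd 2 u) + card (nbhd 4 u) - card {b, d}"
      unfolding A_def by (intro card_Un_le_diff) auto
    moreover have "b \<noteq> d" using p assms by auto
    ultimately have "card A \<le> 28"
      using card_nbhd_2[of u] card_nbhd_4[of u] by simp
    moreover have "{a, e} \<subseteq> B \<inter> nbhd 1 u"
      using assms p rev nb[of "[(u, a)]" a 1] nb[of "[(u, e)]" e 1]
        nb[of "[(u, e), (e, d), (d, c), (c, b), (b, a)]" a 5]
        nb[of "[(u, a), (a, b), (b, c), (c, d), (d, e)]" e 5] unfolding B_def
      by (auto simp: apath_simps awalk_simps in_arcsD2)
    moreover have "a \<noteq> e" using p assms by auto
    ultimately show ?thesis using D[of a e B] w A B fin by (simp add: B_def)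
  qed
qed

text \<open>The uncoloured neighbour \<open>w\<close> lowers the first count to 2, and
  \<open>x\<close>, which ends a path of length 2, lowers the second to 5 + 24. The total is 6 + 58
  + 60 = 124.\<close>

lemma weight_missing_walk:
  assumes arcs: "(u, w) \<in> parcs G" "(w, x) \<in> parcs G" and "u \<noteq> x" "w \<notin> S" "x \<notin> S"
  shows "weight S u \<le> 124"
proof -
  have "u \<noteq> w" "w \<noteq> x"
    using arcs no_loops' by auto
  then have walks: "apath u [(u, w)] w" "apath u [(u, w), (w, x)] x"
    using assms by (auto simp: apath_simps in_arcsD1 in_arcsD2)
  have "w \<in> nbhd 1 u" "x \<in> nbhd 2 u"
    unfolding path_nbhd_def using walks \<open>u \<noteq> w\<close> \<open>u \<noteq> x\<close> arcs by (force simp: in_arcsD2)+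
  then have c: "card (nbhd 1 u - {w}) \<le> 2" "card (nbhd 2 u - {x}) \<le> 5"
    using card_nbhd_1[of u] card_nbhd_2[of u] by (simp_all add: card_Diff_singleton)
  have 1: "card (nbhd 1 u \<inter> S) \<le> 2"
    using assms by (intro order_trans[OF card_mono c(1)]) auto
  have "card ((nbhd 2 u \<union> nbhd 4 u - nbhd 1 u) \<inter> S) \<le> card ((nbhd 2 u - {x}) \<union> nbhd 4 u)"
    using assms by (intro card_mono) auto
  also have "\<dots> \<le> 5 + 24"
    using c(2) card_nbhd_4 by (intro order_trans[OF card_Un_le] add_mono)
  finally have 2: "card ((nbhd 2 u \<union> nbhd 4 u - nbhd 1 u) \<inter> S) \<le> 29" by simp
  have "card ((nbhd 3 u \<union> nbhd 5 u - nbhd 1 u) \<inter> S) \<le> card (nbhd 3 u \<union> nbhd 5 u)"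
    by (intro card_mono) auto
  also have "\<dots> \<le> 12 + 48"
    using card_nbhd_3 card_nbhd_5 by (intro order_trans[OF card_Un_le] add_mono)
  finally show ?thesis
    using 1 2 unfolding weight_def by linarith
qed

section \<open>Greedy colouring\<close>

text \<open>In a colour \<open>(c, i)\<close>, \<open>c\<close> is the index of an admissible set and \<open>i\<close> of a part of it.\<close>

definition colours :: "(nat \<times> nat) set" where
  "colours = {..<42} \<times> {1..3}"

definition conflict :: "nat \<times> nat \<Rightarrow> nat \<times> nat \<Rightarrow> 'a \<Rightarrow> 'a set" where
  "conflict c c' u =
     (if fst c \<noteq> fst c' then {}
      else if snd c = snd c' then nbhd 1 u \<union> nbhd 3 u \<union> nbhd 5 u
      else nbhd 1 u \<union> nbhd 2 u \<union> nbhd 4 u)"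

definition colouring :: "'a set \<Rightarrow> ('a \<Rightarrow> nat \<times> nat) \<Rightarrow> bool" where
  "colouring S f \<longleftrightarrow> f ` S \<subseteq> colours \<and> (\<forall>u\<in>S. \<forall>v\<in>S. v \<notin> conflict (f u) (f v) u)"

lemma conflict_sym: "u \<in> pverts G \<Longrightarrow> v \<in> conflict c c' u \<Longrightarrow> u \<in> conflict c' c v"
  using nbhd_sym by (auto simp: conflict_def split: if_splits)

text \<open>The forbidden colours are covered by three sets matching the terms of
  \<open>weight\<close>: a neighbour blocks all three parts of its class (\<open>FA\<close>), the
  end of a path of length 2 or 4 the two parts other than its own (\<open>FB\<close>), the end of a
  path of length 3 or 5 its own colour (\<open>FC\<close>). Fewer than \<open>card colours\<close>
  are blocked, so one is free.\<close>

lemma colouring_extend: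
  assumes col: "colouring S f" and S: "S \<subseteq> pverts G" and u: "u \<in> pverts G" "u \<notin> S"
    and weight: "weight S u < card colours"
  shows "\<exists>c. colouring (insert u S) (f(u := c))"
proof -
  let ?A = "nbhd 1 u \<inter> S" and ?B = "(nbhd 2 u \<union> nbhd 4 u - nbhd 1 u) \<inter> S"
    and ?C = "(nbhd 3 u \<union> nbhd 5 u - nbhd 1 u) \<inter> S"
  have f: "snd (f v) \<in> {1..3}" if "v \<in> S" for v
    using col that by (force simp: colouring_def colours_def)
  define FA where "FA = (\<Union>v\<in>?A. {fst (f v)} \<times> {1..3 :: nat})"
  define FB where "FB = (\<Union>v\<in>?B. {fst (f v)} \<times> ({1..3 :: nat} - {snd (f v)}))"
  define FC where "FC = f ` ?C"
  have "card FA \<le> (\<Sum>v\<in>?A. card ({fst (f v)} \<times> {1..3 :: nat}))"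
    unfolding FA_def by (rule card_UN_le) simp
  then have "card FA \<le> 3 * card ?A" by simp
  moreover have "card FB \<le> (\<Sum>v\<in>?B. card ({fst (f v)} \<times> ({1..3 :: nat} - {snd (f v)})))"
    unfolding FB_def by (rule card_UN_le) simp
  then have "card FB \<le> (\<Sum>v\<in>?B. 2)"
    using f by (simp add: card_cartesian_product card_Diff_singleton)
  then have "card FB \<le> 2 * card ?B" by simp
  moreover have "card FC \<le> card ?C"
    unfolding FC_def by (rule card_image_le) simp
  moreover have "card (FA \<union> FB \<union> FC) \<le> card FA + card FB + card FC"
    using card_Un_le[of "FA \<union> FB" FC] card_Un_le[of FA FB] by linarith
  ultimately have "card (FA \<union> FB \<union> FC) < card colours"
    using weight unfolding weight_def by linarith
  moreover have "finite (FA \<union> FB \<union> FC)"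
    by (auto simp: FA_def FB_def FC_def)
  ultimately obtain c where c: "c \<in> colours" "c \<notin> FA \<union> FB \<union> FC"
    by (meson card_mono leD subsetI)
  have out: "v \<notin> conflict c (f v) u" if "v \<in> S" for v
  proof
    assume v: "v \<in> conflict c (f v) u"
    then have "fst c = fst (f v)" by (auto simp: conflict_def split: if_splits)
    moreover have "snd c \<in> {1..3}" using c by (auto simp: colours_def)
    ultimately have "v \<in> nbhd 1 u \<Longrightarrow> c \<in> FA"
      and "snd c \<noteq> snd (f v) \<Longrightarrow> v \<in> nbhd 2 u \<union> nbhd 4 u \<Longrightarrow> v \<notin> nbhd 1 u \<Longrightarrow> c \<in> FB"
      and "snd c = snd (f v) \<Longrightarrow> v \<in> nbhd 3 u \<union> nbhd 5 u \<Longrightarrow> v \<notin> nbhd 1 u \<Longrightarrow> c \<in> FC"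
      using that by (auto simp: FA_def FB_def FC_def prod_eq_iff mem_Times_iff image_iff)
    with v c(2) show False by (auto simp: conflict_def split: if_splits)
  qed
  moreover have "u \<notin> conflict c c u"
    by (auto simp: conflict_def path_nbhd_def)
  \<comment> \<open>\<open>colouring\<close> quantifies over ordered pairs; the reverse order
    follows by reversing paths.\<close>
  moreover have "u \<notin> conflict (f v) c v" if "v \<in> S" for v
    using out[OF that] conflict_sym[of v u "f v" c] that S by auto
  ultimately have "colouring (insert u S) (f(u := c))"
    using col c(1) u(2) by (auto simp: colouring_def)
  then show ?thesis ..
qed

lemma ex_colouring:
  assumes "connected G" "girth G \<le> 6"
  shows "\<exists>f. colouring (pverts G) f"
proof -
  \<comment> \<open>If there were no such cycle, the infimum would be at least 7, or \<infinity>
    over the empty set.\<close>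
  have "\<exists>p. cycle p \<and> 3 \<le> length p \<and> length p \<le> 6"
  proof (rule ccontr)
    assume "\<not> ?thesis"
    then have "enat 7 \<le> girth G"
      unfolding girth_def by (intro INF_greatest) (auto simp: not_le)
    then have "enat 7 \<le> 6" using assms(2) by (rule order_trans)
    then show False by (simp add: numeral_eq_enat)
  qed
  then obtain p where p: "cycle p" "3 \<le> length p" "length p \<le> 6" by blast
  obtain C where C: "C \<subseteq> pverts G" "C \<noteq> {}"
    and walk: "\<And>u. u \<in> C \<Longrightarrow>
      \<exists>q. awalk u q u \<and> distinct (map snd q) \<and> length q = length p \<and> snd ` set q \<subseteq> C"
    using cycle_at_vertex[OF p(1)] by metis
  obtain d :: "'a \<Rightarrow> nat" where d0: "\<And>v. v \<in> C \<Longrightarrow> d v = 0"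
    and d: "\<And>v. v \<in> pverts G \<Longrightarrow> v \<notin> C \<Longrightarrow> \<exists>w. (v, w) \<in> parcs G \<and> d w < d v"
    using ex_decreasing_rank[OF assms(1) C] by metis
  have weight: "weight S u \<le> 125" if u: "u \<in> pverts G" and S: "\<And>v. v \<in> S \<Longrightarrow> d u \<le> d v" for S u
  proof (cases "u \<in> C")
    case True
    then show ?thesis using walk[OF True] p weight_closed_walk by metis
  next
    case False
    with u d obtain w where w: "(u, w) \<in> parcs G" "d w < d u" by blast
    \<comment> \<open>On \<open>C\<close> the successor of \<open>w\<close> again has rank 0; off
      \<open>C\<close> the rank drops once more. In both cases \<open>d x < d u\<close> makes
      \<open>x\<close> uncoloured and different from \<open>u\<close>.\<close>
    have "\<exists>x. (w, x) \<in> parcs G \<and> d x < d u"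
    proof (cases "w \<in> C")
      case True
      with walk obtain q where q: "awalk w q w" "length q = length p" "snd ` set q \<subseteq> C"
        by blast
      then obtain x r where "q = (w, x) # r"
        using p(2) by (cases q) (auto simp: awalk_simps)
      with q w d0 show ?thesis by (auto simp: awalk_simps)
    next
      case False
      with w d[of w] show ?thesis by (meson in_arcsD2 order.strict_trans)
    qed
    then obtain x where x: "(w, x) \<in> parcs G" "d x < d u" by blast
    then have "weight S u \<le> 124"
      using w S by (intro weight_missing_walk[of u w x]) (auto simp: not_le[symmetric])
    then show ?thesis by simp
  qed
  have "S \<subseteq> pverts G \<longrightarrow> (\<exists>f. colouring S f)" if "finite S" for S
    using that
  \<comment> \<open>Ranking by the negated distance makes the newly inserted \<open>u\<close> a
    vertex of least \<open>d\<close>, so vertices are coloured from the farthest inwards.\<close>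
  proof (induction S rule: finite_ranking_induct[where f = "\<lambda>v. - int (d v)"])
    case (insert u S)
    show ?case
    proof (intro impI, cases "u \<in> S")
      case False
      assume sub: "insert u S \<subseteq> pverts G"
      then obtain f where f: "colouring S f" using insert by auto
      have "weight S u \<le> 125"
        using insert(2) sub by (intro weight) auto
      moreover have "card colours = 126" by (simp add: colours_def)
      ultimately show "\<exists>f. colouring (insert u S) f"
        using colouring_extend[OF f, of u] sub False by auto
    qed (use insert in \<open>auto simp: insert_absorb\<close>)
  qed (auto simp: colouring_def)
  then show ?thesis using finite_verts by blast
qed

section \<open>From the colouring to the partition\<close>

lemma ex_admissible_partition:
  assumes "connected G" "girth G \<le> 6"
  shows "\<exists>P. partition_on (pverts G) P \<and> card P \<le> 42 \<and> (\<forall>X\<in>P. admissible G X)"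
proof -
  obtain f where f: "colouring (pverts G) f" using ex_colouring[OF assms] by blast
  define X where "X c = {v \<in> pverts G. fst (f v) = c}" for c
  \<comment> \<open>Only class indices that occur are used, because a partition has no empty
    block.\<close>
  define P where "P = X ` (fst ` f ` pverts G)"
  have "partition_on (pverts G) P"
    by (rule partition_onI) (auto simp: P_def X_def disjnt_def)
  moreover have "fst ` f ` pverts G \<subseteq> {..<42}"
    using f by (auto simp: colouring_def colours_def)
  then have "card P \<le> card {..<42 :: nat}"
    unfolding P_def by (meson card_image_le card_mono finite_lessThan finite_subset le_trans)
  moreover have "admissible G (X c)" for c
  proof -
    have no_conflict: "v \<notin> conflict (f u) (f v) u" if "u \<in> pverts G" "v \<in> pverts G" for u v
      using f that by (simp add: colouring_def)
    define Y where "Y i = {v \<in> X c. snd (f v) = i}" for i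
    have "snd (f v) \<in> {1..3}" if "v \<in> pverts G" for v
      using f that by (force simp: colouring_def colours_def)
    then have "X c = (\<Union>i\<in>{1..3}. Y i)"
      unfolding X_def Y_def by blast
    moreover have "disjoint_family_on Y {1..3}"
      by (auto simp: disjoint_family_on_def Y_def)
    moreover have "v \<notin> nbhd 1 u \<union> nbhd 3 u \<union> nbhd 5 u" if "u \<in> Y i" "v \<in> Y i" for i u v
      using no_conflict[of u v] that unfolding X_def Y_def conflict_def by simp
    moreover have "v \<notin> nbhd 1 u \<union> nbhd 2 u \<union> nbhd 4 u" if "u \<in> Y i" "v \<in> Y j" "i \<noteq> j" for i j u v
      using no_conflict[of u v] that unfolding X_def Y_def conflict_def by simp
    moreover have "X c \<subseteq> pverts G" by (auto simp: X_def)
    ultimately show ?thesis unfolding admissible_def by auto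
  qed
  ultimately show ?thesis by (auto simp: P_def)
qed

end

theorem theorem5:
  fixes G :: "'a pair_pre_digraph"
  assumes "pair_graph G"
    and "triangle_free (with_proj G)"
    and "max_degree (with_proj G) \<le> 3"
    and "k_connected 2 (with_proj G)"
    and "girth (with_proj G) \<le> 6"
  shows "\<exists>P. partition_on (pverts G) P \<and> card P \<le> 42 \<and> (\<forall>X\<in>P. admissible (with_proj G) X)"
proof -
  interpret pair_graph G by fact
  interpret subcubic_graph G
  proof
    fix v assume "v \<in> pverts G"
    then have "out_degree G v \<le> max_degree G"
      unfolding max_degree_def with_proj_simps
      by (intro cSUP_upper bdd_above_finite finite_imageI finite_verts)
    with assms(3) show "out_degree G v \<le> 3" by simp
  qed
  \<comment> \<open>Removing the empty set of vertices, of size 0 < 2, yields connectedness of the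
    whole graph.\<close>
  have "connected (with_proj G \<restriction> (pverts G - {}))"
    using assms(4) unfolding k_connected_def with_proj_simps
    by (elim conjE allE[of _ "{}"]) simp
  moreover have "with_proj G \<restriction> pverts G = with_proj G"
  proof -
    have "{e \<in> parcs G. fst e \<in> pverts G \<and> snd e \<in> pverts G} = parcs G"
      using arc_fst_in_verts arc_snd_in_verts by blast
    then show ?thesis
      unfolding induce_subgraph_def with_proj_simps by (simp add: with_proj_def)
  qed
  ultimately show ?thesis
    using ex_admissible_partition assms(5) by simp
qed

end
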